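(* Let $M>0$, $0\le|Q|<M$, $\mu>0$, $f(r)=1-\frac{2M}{r}+\frac{Q^2}{r^2}$. For every $\ell\ge1$, the even frequency-domain system $$u_2''+\Bigl(\omega^2-f\mu^2-f\frac{\ell(\ell+1)}{r^2}\Bigr)u_2-\frac{2f}{r^2}\Bigl(f-\frac{r\,\partial_rf}{2}\Bigr)(u_2-u_3)=0,\qquad u_3''+\Bigl(\omega^2-f\mu^2-f\frac{\ell(\ell+1)}{r^2}\Bigr)u_3+\frac{2f\,\ell(\ell+1)}{r^2}u_2=0$$ takes, in the variables $\bm v=\binom{v_{-1}}{v_{+1}}$ with $v_{-1}=\frac{\ell u_2+u_3}{2\ell+1}$, $v_{+1}=\frac{(\ell+1)u_2-u_3}{2\ell+1}$, the matrix form $$\bm v''+(\omega^2-f\mu^2)\bm v-\frac{f}{r^2}D_\ell\bm v-\frac{6Mf}{(2\ell+1)r^3}C_\ell\bm v+\frac{4Q^2f}{(2\ell+1)r^4}C_\ell\bm v=0,$$ where $$D_\ell=\operatorname{diag}\bigl(\ell(\ell-1),(\ell+1)(\ell+2)\bigr),\qquad C_\ell=\begin{pmatrix}\ell^2&-\ell(\ell+1)\\ \ell(\ell+1)&-(\ell+1)^2\end{pmatrix}.$$ In particular, the leading $r^{-2}$ part diagonalizes exactly, with effective angular momenta $L_{-1}=\ell-1$, $L_{+1}=\ell+1$ (i.e. $D_\ell=\operatorname{diag}(L_{-1}(L_{-1}+1),L_{+1}(L_{+1}+1))$), and the charge $Q$ first enters the even coupling at order $r^{-4}$.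
   Context: Here $r>r_+=M+\sqrt{M^2-Q^2}$, the tortoise coordinate $r_*$ is defined by $dr_*/dr=1/f$, and $'=\partial_{r_*}$. The system is the even-parity part of the neutral Proca equation $\nabla^\mu F_{\mu\nu}-\mu^2A_\nu=0$ on the Reissner--Nordström exterior after spherical-harmonic decomposition and Fourier transform with time dependence $e^{-i\omega t}$. "Order" in the last sentence counts explicit powers of $r^{-1}$ multiplying $f$ in the displayed matrix form. *)

theory Defs
  imports "HOL-Analysis.Analysis"
begin

definition rn_f :: "real \<Rightarrow> real \<Rightarrow> real \<Rightarrow> real" where
  "rn_f M Q r = 1 - 2 * M / r + Q\<^sup>2 / r\<^sup>2"

definition r_plus :: "real \<Rightarrow> real \<Rightarrow> real" where
  "r_plus M Q = M + sqrt (M\<^sup>2 - Q\<^sup>2)"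

abbreviation exterior :: "real \<Rightarrow> real \<Rightarrow> real set" where
  "exterior M Q \<equiv> {r_plus M Q<..}"

text \<open>The tortoise coordinate is fixed only up to an additive constant, so it is a predicate.\<close>

definition tortoise_coordinate :: "real \<Rightarrow> real \<Rightarrow> (real \<Rightarrow> real) \<Rightarrow> bool" where
  "tortoise_coordinate M Q rs \<longleftrightarrow>
     (\<forall>r\<in>exterior M Q. (rs has_real_derivative 1 / rn_f M Q r) (at r))"

text \<open>All unknowns are functions of the area radius on the exterior. Their derivative with
  respect to the tortoise coordinate is the ordinary derivative of the function re-expressed
  in that coordinate, the value being attached again to the point with radius r.\<close>

definition has_rs_derivative ::
  "real \<Rightarrow> real \<Rightarrow> (real \<Rightarrow> real) \<Rightarrow> (real \<Rightarrow> 'a::real_normed_vector) \<Rightarrow> (real \<Rightarrow> 'a) \<Rightarrow> bool" where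
  "has_rs_derivative M Q rs u u' \<longleftrightarrow>
     (\<forall>r\<in>exterior M Q.
        ((u \<circ> inv_into (exterior M Q) rs) has_vector_derivative u' r) (at (rs r)))"

definition has_second_rs_derivative ::
  "real \<Rightarrow> real \<Rightarrow> (real \<Rightarrow> real) \<Rightarrow> (real \<Rightarrow> 'a::real_normed_vector) \<Rightarrow> (real \<Rightarrow> 'a) \<Rightarrow> bool" where
  "has_second_rs_derivative M Q rs u u'' \<longleftrightarrow>
     (\<exists>u'. has_rs_derivative M Q rs u u' \<and> has_rs_derivative M Q rs u' u'')"

definition even_system ::
  "real \<Rightarrow> real \<Rightarrow> real \<Rightarrow> complex \<Rightarrow> nat \<Rightarrow> (real \<Rightarrow> real) \<Rightarrow>
   (real \<Rightarrow> complex) \<Rightarrow> (real \<Rightarrow> complex) \<Rightarrow> bool" where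
  "even_system M Q \<mu> \<omega> l rs u2 u3 \<longleftrightarrow>
    (\<exists>u2'' u3''.
       has_second_rs_derivative M Q rs u2 u2'' \<and>
       has_second_rs_derivative M Q rs u3 u3'' \<and>
       (\<forall>r\<in>exterior M Q. let f = rn_f M Q in
          u2'' r
          + (\<omega>\<^sup>2 - of_real (f r * \<mu>\<^sup>2) - of_real (f r * (real l * (real l + 1)) / r\<^sup>2)) * u2 r
          - of_real (2 * f r / r\<^sup>2 * (f r - r * deriv f r / 2)) * (u2 r - u3 r) = 0 \<and>
          u3'' r
          + (\<omega>\<^sup>2 - of_real (f r * \<mu>\<^sup>2) - of_real (f r * (real l * (real l + 1)) / r\<^sup>2)) * u3 r
          + of_real (2 * f r * (real l * (real l + 1)) / r\<^sup>2) * u2 r = 0))"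

definition v_minus :: "nat \<Rightarrow> (real \<Rightarrow> complex) \<Rightarrow> (real \<Rightarrow> complex) \<Rightarrow> real \<Rightarrow> complex" where
  "v_minus l u2 u3 r = (of_nat l * u2 r + u3 r) / (2 * of_nat l + 1)"

definition v_plus :: "nat \<Rightarrow> (real \<Rightarrow> complex) \<Rightarrow> (real \<Rightarrow> complex) \<Rightarrow> real \<Rightarrow> complex" where
  "v_plus l u2 u3 r = ((of_nat l + 1) * u2 r - u3 r) / (2 * of_nat l + 1)"

definition v_vec :: "nat \<Rightarrow> (real \<Rightarrow> complex) \<Rightarrow> (real \<Rightarrow> complex) \<Rightarrow> real \<Rightarrow> complex^2" where
  "v_vec l u2 u3 r = vector [v_minus l u2 u3 r, v_plus l u2 u3 r]"

definition diag2 :: "complex \<Rightarrow> complex \<Rightarrow> complex^2^2" where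
  "diag2 a b = vector [vector [a, 0], vector [0, b]]"

definition D_mat :: "nat \<Rightarrow> complex^2^2" where
  "D_mat l = diag2 (of_nat l * (of_nat l - 1)) ((of_nat l + 1) * (of_nat l + 2))"

definition C_mat :: "nat \<Rightarrow> complex^2^2" where
  "C_mat l = vector [vector [(of_nat l)\<^sup>2, - (of_nat l * (of_nat l + 1))],
                     vector [of_nat l * (of_nat l + 1), - ((of_nat l + 1)\<^sup>2)]]"

definition even_coupling :: "real \<Rightarrow> real \<Rightarrow> nat \<Rightarrow> real \<Rightarrow> complex^2 \<Rightarrow> complex^2" where
  "even_coupling M Q l r x =
     - (rn_f M Q r / r\<^sup>2) *\<^sub>R (D_mat l *v x)
     - (6 * M * rn_f M Q r / ((2 * real l + 1) * r ^ 3)) *\<^sub>R (C_mat l *v x)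
     + (4 * Q\<^sup>2 * rn_f M Q r / ((2 * real l + 1) * r ^ 4)) *\<^sub>R (C_mat l *v x)"

definition even_matrix_system ::
  "real \<Rightarrow> real \<Rightarrow> real \<Rightarrow> complex \<Rightarrow> nat \<Rightarrow> (real \<Rightarrow> real) \<Rightarrow> (real \<Rightarrow> complex^2) \<Rightarrow> bool" where
  "even_matrix_system M Q \<mu> \<omega> l rs v \<longleftrightarrow>
    (\<exists>v''. has_second_rs_derivative M Q rs v v'' \<and>
       (\<forall>r\<in>exterior M Q.
          v'' r + (\<omega>\<^sup>2 - of_real (rn_f M Q r * \<mu>\<^sup>2)) *s v r + even_coupling M Q l r (v r) = 0))"

text \<open>The coefficient family A expands the coupling in explicit powers of 1/r multiplying f:
  A k is the matrix at order k. The factor f, which itself depends on Q and r, is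
  kept unexpanded. The overall sign makes the matrix at order 2 a centrifugal one.\<close>

definition coupling_expansion :: "real \<Rightarrow> real \<Rightarrow> nat \<Rightarrow> (nat \<Rightarrow> complex^2^2) \<Rightarrow> bool" where
  "coupling_expansion M Q l A \<longleftrightarrow>
     finite {k. A k \<noteq> 0} \<and>
     (\<forall>r\<in>exterior M Q. \<forall>x.
        even_coupling M Q l r x =
          - (rn_f M Q r *\<^sub>R (\<Sum>k | A k \<noteq> 0. (1 / r ^ k) *\<^sub>R (A k *v x))))"

text \<open>Effective angular momentum of the component labelled s = -1 or s = +1.\<close>

definition L_eff :: "nat \<Rightarrow> int \<Rightarrow> int" where
  "L_eff l s = int l + s"

end

theory Submission
  imports Defs
begin

text \<open>The substitution is a constant invertible linear map acting on the pair of unknowns, with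
  inverse \<open>u2 = v_minus + v_plus\<close> and \<open>u3 = (l + 1) v_minus - l v_plus\<close>. A constant linear map
  commutes with the tortoise derivative, and it carries the left-hand sides of the scalar system
  to the left-hand side of the matrix system (\<open>matrix_residual\<close>), so the two systems vanish
  together.

  The form of the coupling comes from \<open>f - r f' / 2 = 1 - 3 M / r + 2 Q\<^sup>2 / r\<^sup>2\<close>.
  The leading 1 combines with the angular terms into a matrix that the substitution diagonalizes
  to \<open>D_mat l\<close>. The two corrections both multiply \<open>u2 - u3 = - l v_minus + (l + 1) v_plus\<close>,
  which enters only the first equation; the resulting rank-one matrix is
  proportional to \<open>C_mat l\<close>. Hence, beyond the common factor \<open>f\<close>, mass appears at order 3 and
  charge at order 4; for \<open>l \<ge> 1\<close> the off-diagonal entries of \<open>C_mat l\<close> do not vanish, so the charge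
  really couples the two components there.

  The statements about orders quantify over every expansion in powers of \<open>1 / r\<close>. On the exterior
  \<open>f\<close> has no zero, so it can be cancelled, and a polynomial in \<open>1 / r\<close> that vanishes on a half-line
  is zero. The expansion is therefore unique (\<open>coupling_expansion_unique\<close>) and its coefficients can
  be read off from \<open>coupling_expansion_even_coeff\<close>.\<close>

section \<open>The tortoise derivative and constant linear maps\<close>

lemma has_second_rs_derivative_bounded_linear:
  assumes "bounded_linear h" and "has_second_rs_derivative M Q rs u u''"
  shows "has_second_rs_derivative M Q rs (\<lambda>r. h (u r)) (\<lambda>r. h (u'' r))"
proof -
  have "has_rs_derivative M Q rs (\<lambda>r. h (w r)) (\<lambda>r. h (w' r))"
    if "has_rs_derivative M Q rs w w'" for w w'
    using that bounded_linear.has_vector_derivative[OF assms(1)]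
    unfolding has_rs_derivative_def comp_def by blast
  then show ?thesis
    using assms(2) unfolding has_second_rs_derivative_def by blast
qed

lemma has_second_rs_derivative_add:
  assumes "has_second_rs_derivative M Q rs u u''" and "has_second_rs_derivative M Q rs w w''"
  shows "has_second_rs_derivative M Q rs (\<lambda>r. u r + w r) (\<lambda>r. u'' r + w'' r)"
proof -
  have "has_rs_derivative M Q rs (\<lambda>r. a r + b r) (\<lambda>r. a' r + b' r)"
    if "has_rs_derivative M Q rs a a'" "has_rs_derivative M Q rs b b'" for a a' b b'
    using that unfolding has_rs_derivative_def comp_def
    by (simp add: has_vector_derivative_add)
  then show ?thesis
    using assms unfolding has_second_rs_derivative_def by blast
qed

section \<open>The change of variables\<close>

lemma two_l_plus_one_nonzero: "2 * of_nat l + 1 \<noteq> (0 :: complex)"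
proof -
  have "2 * of_nat l + 1 = (of_nat (2 * l + 1) :: complex)" by simp
  then show ?thesis by (simp only: of_nat_eq_0_iff)
qed

lemma u2_from_v_vec: "v_vec l u2 u3 r $ 1 + v_vec l u2 u3 r $ 2 = u2 r"
  using two_l_plus_one_nonzero[of l]
  by (simp add: v_vec_def v_minus_def v_plus_def divide_simps) (simp add: algebra_simps)

lemma u3_from_v_vec:
  "(of_nat l + 1) * v_vec l u2 u3 r $ 1 - of_nat l * v_vec l u2 u3 r $ 2 = u3 r"
  using two_l_plus_one_nonzero[of l]
  by (simp add: v_vec_def v_minus_def v_plus_def divide_simps) (simp add: algebra_simps)

lemma v_vec_eq_0_iff: "v_vec l a b r = 0 \<longleftrightarrow> a r = 0 \<and> b r = 0"
proof
  assume "v_vec l a b r = 0"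
  then show "a r = 0 \<and> b r = 0"
    using u2_from_v_vec[of l a b r] u3_from_v_vec[of l a b r] by simp
next
  assume "a r = 0 \<and> b r = 0"
  then show "v_vec l a b r = 0"
    by (simp add: v_vec_def v_minus_def v_plus_def vec_eq_iff forall_2)
qed

lemma v_vec_of_inverse:
  "v_vec l (\<lambda>r. w r $ 1 + w r $ 2) (\<lambda>r. (of_nat l + 1) * w r $ 1 - of_nat l * w r $ 2) r = w r"
  using two_l_plus_one_nonzero[of l]
  by (simp add: v_vec_def v_minus_def v_plus_def vec_eq_iff forall_2 divide_simps)
     (simp add: algebra_simps)

text \<open>Each unknown enters through its own constant vector, a column of the substitution
  matrix.\<close>

lemma has_second_rs_derivative_v_vec:
  assumes "has_second_rs_derivative M Q rs u2 u2''" and "has_second_rs_derivative M Q rs u3 u3''"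
  shows "has_second_rs_derivative M Q rs (v_vec l u2 u3) (v_vec l u2'' u3'')"
proof -
  define p q :: "complex^2" where
    "p = vector [of_nat l / (2 * of_nat l + 1), (of_nat l + 1) / (2 * of_nat l + 1)]" and
    "q = vector [1 / (2 * of_nat l + 1), - 1 / (2 * of_nat l + 1)]"
  have lin: "bounded_linear (\<lambda>c. c *s w)" for w :: "complex^2"
    by (rule linear_conv_bounded_linear[THEN iffD1], rule linearI)
       (auto simp: vec_eq_iff algebra_simps)
  have split: "v_vec l a b = (\<lambda>r. a r *s p + b r *s q)" for a b
    by (rule ext, simp add: v_vec_def v_minus_def v_plus_def p_def q_def vec_eq_iff forall_2)
       (simp add: algebra_simps add_divide_distrib diff_divide_distrib)
  show ?thesis
    unfolding split
    by (rule has_second_rs_derivative_add[OF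
          has_second_rs_derivative_bounded_linear[OF lin assms(1)]
          has_second_rs_derivative_bounded_linear[OF lin assms(2)]])
qed

lemma has_second_rs_derivative_from_v_vec:
  assumes "has_second_rs_derivative M Q rs (v_vec l u2 u3) v''"
  shows "has_second_rs_derivative M Q rs u2 (\<lambda>r. v'' r $ 1 + v'' r $ 2)"
    and "has_second_rs_derivative M Q rs u3
           (\<lambda>r. (of_nat l + 1) * v'' r $ 1 - of_nat l * v'' r $ 2)"
proof -
  have "bounded_linear (\<lambda>w :: complex^2. w $ 1 + w $ 2)"
    by (intro bounded_linear_add bounded_linear_vec_nth)
  from has_second_rs_derivative_bounded_linear[OF this assms]
  show "has_second_rs_derivative M Q rs u2 (\<lambda>r. v'' r $ 1 + v'' r $ 2)"
    by (simp only: u2_from_v_vec)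
  have "bounded_linear (\<lambda>w :: complex^2. (of_nat l + 1) * w $ 1 - of_nat l * w $ 2)"
    by (intro bounded_linear_sub bounded_linear_const_mult bounded_linear_vec_nth)
  from has_second_rs_derivative_bounded_linear[OF this assms]
  show "has_second_rs_derivative M Q rs u3
           (\<lambda>r. (of_nat l + 1) * v'' r $ 1 - of_nat l * v'' r $ 2)"
    by (simp only: u3_from_v_vec)
qed

section \<open>The two systems have equivalent residuals\<close>

lemma exterior_pos:
  assumes "M > 0" and "\<bar>Q\<bar> < M" and "r \<in> exterior M Q"
  shows "r > 0"
proof -
  have "Q\<^sup>2 \<le> M\<^sup>2" using assms by (simp add: abs_le_square_iff[symmetric])
  then have "sqrt (M\<^sup>2 - Q\<^sup>2) \<ge> 0" by simp
  then show ?thesis using assms unfolding r_plus_def greaterThan_iff by linarith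
qed

text \<open>The roots of \<open>r\<^sup>2 f\<close> are \<open>M \<plusminus> sqrt (M\<^sup>2 - Q\<^sup>2)\<close>, and \<open>r_plus\<close> is the larger one.\<close>

lemma rn_f_pos_exterior:
  assumes "M > 0" and "\<bar>Q\<bar> < M" and "r \<in> exterior M Q"
  shows "rn_f M Q r > 0"
proof -
  have Q: "Q\<^sup>2 \<le> M\<^sup>2" using assms by (simp add: abs_le_square_iff[symmetric])
  have r: "r > 0" using exterior_pos[OF assms] .
  have "sqrt (M\<^sup>2 - Q\<^sup>2) < r - M" using assms(3) by (simp add: r_plus_def)
  then have "(sqrt (M\<^sup>2 - Q\<^sup>2))\<^sup>2 < (r - M)\<^sup>2"
    using Q by (intro power_strict_mono) auto
  then have "M\<^sup>2 - Q\<^sup>2 < (r - M)\<^sup>2" using Q by simp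
  then have "0 < (r\<^sup>2 - 2 * M * r + Q\<^sup>2) / r\<^sup>2"
    using r by (simp add: power2_eq_square algebra_simps)
  also have "\<dots> = rn_f M Q r"
    using r by (simp add: rn_f_def field_simps power2_eq_square)
  finally show ?thesis .
qed

lemma rn_f_coupling_factor:
  assumes "r \<noteq> 0"
  shows "rn_f M Q r - r * deriv (rn_f M Q) r / 2 = 1 - 3 * M / r + 2 * Q\<^sup>2 / r\<^sup>2"
proof -
  have "(rn_f M Q has_real_derivative (2 * M / r\<^sup>2 - 2 * Q\<^sup>2 / r ^ 3)) (at r)"
    unfolding rn_f_def[abs_def] using assms
    by (auto intro!: derivative_eq_intros simp: field_simps power2_eq_square power3_eq_cube)
  then have d: "deriv (rn_f M Q) r = 2 * M / r\<^sup>2 - 2 * Q\<^sup>2 / r ^ 3" by (rule DERIV_imp_deriv)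
  show ?thesis
    unfolding d using assms by (simp add: rn_f_def field_simps power2_eq_square power3_eq_cube)
qed

text \<open>Substituting \<open>u2 = x + y\<close> and \<open>u3 = (l + 1) x - l y\<close> into the combinations \<open>l E2 + E3\<close> and
  \<open>(l + 1) E2 - E3\<close> of the scalar residuals, every undifferentiated term, apart from the two
  corrections in \<open>f - r f' / 2\<close>, acquires the factor \<open>2 l + 1\<close>, which the normalization of the substitution
  removes; the corrections keep the factor \<open>1 / (2 l + 1)\<close>. The values \<open>a2\<close> and \<open>a3\<close> stand for the
  second derivatives. Because this is an identity of residuals, not an implication between
  equations, it serves both directions of the equivalence.\<close>

lemma matrix_residual:
  fixes M Q :: real
  assumes "r \<noteq> 0"
  defines "f \<equiv> rn_f M Q"
  shows "v_vec l a2 a3 r + (\<omega>\<^sup>2 - of_real (f r * \<mu>\<^sup>2)) *s v_vec l u2 u3 r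
           + even_coupling M Q l r (v_vec l u2 u3 r)
       = v_vec l
          (\<lambda>r. a2 r
            + (\<omega>\<^sup>2 - of_real (f r * \<mu>\<^sup>2) - of_real (f r * (real l * (real l + 1)) / r\<^sup>2)) * u2 r
            - of_real (2 * f r / r\<^sup>2 * (f r - r * deriv f r / 2)) * (u2 r - u3 r))
          (\<lambda>r. a3 r
            + (\<omega>\<^sup>2 - of_real (f r * \<mu>\<^sup>2) - of_real (f r * (real l * (real l + 1)) / r\<^sup>2)) * u3 r
            + of_real (2 * f r * (real l * (real l + 1)) / r\<^sup>2) * u2 r) r"
proof -
  define n R F m q W where "n = (of_nat l :: complex)" and "R = (of_real r :: complex)"
    and "F = (of_real (f r) :: complex)" and "m = (of_real M :: complex)"
    and "q = (of_real Q :: complex)" and "W = \<omega>\<^sup>2 - of_real (f r * \<mu>\<^sup>2)"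
  \<comment> \<open>Naming the denominators makes each component a polynomial identity modulo the single
    relation \<open>K * (2 * n + 1) = 1\<close>.\<close>
  define S K where "S = 1 / R" and "K = 1 / (2 * n + 1)"
  have K: "K * (2 * n + 1) = 1"
    using two_l_plus_one_nonzero[of l] by (simp add: K_def n_def)
  have v: "v_vec l a b r = vector [K * (n * a r + b r), K * ((n + 1) * a r - b r)]" for a b
    by (simp add: v_vec_def v_minus_def v_plus_def K_def n_def)
  have coupling: "even_coupling M Q l r x =
      vector [- (F * S^2) * (n * (n - 1)) * x $ 1
                + (4 * q^2 * S^4 - 6 * m * S^3) * F * K * (n^2 * x $ 1 - n * (n + 1) * x $ 2),
              - (F * S^2) * ((n + 1) * (n + 2)) * x $ 2
                + (4 * q^2 * S^4 - 6 * m * S^3) * F * K * (n * (n + 1) * x $ 1 - (n + 1)^2 * x $ 2)]"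
    for x
    by (simp add: even_coupling_def D_mat_def C_mat_def diag2_def vec_eq_iff forall_2
        matrix_vector_mult_def sum_2 scaleR_conv_of_real[where 'a = complex]
        n_def[symmetric] f_def[symmetric]
        F_def[symmetric] R_def[symmetric] m_def[symmetric] q_def[symmetric])
       (simp add: S_def K_def algebra_simps power_divide add_divide_distrib diff_divide_distrib)
  have g: "of_real (2 * f r / r\<^sup>2 * (f r - r * deriv f r / 2))
      = 2 * F * S^2 * (1 - 3 * m * S + 2 * q^2 * S^2)"
    unfolding f_def rn_f_coupling_factor[OF assms(1)]
    by (simp add: F_def f_def S_def R_def m_def q_def power_divide)
  have c: "of_real (f r * (real l * (real l + 1)) / r\<^sup>2) = F * S^2 * (n * (n + 1))"
    "of_real (2 * f r * (real l * (real l + 1)) / r\<^sup>2) = 2 * F * S^2 * (n * (n + 1))"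
    by (simp_all add: F_def S_def R_def n_def power_divide)
  define x y where "x = v_vec l u2 u3 r $ 1" and "y = v_vec l u2 u3 r $ 2"
  have u: "u2 r = x + y" "u3 r = (n + 1) * x - n * y"
    by (simp_all add: x_def y_def n_def u2_from_v_vec u3_from_v_vec)
  have xy: "v_vec l u2 u3 r = vector [x, y]"
    by (simp add: x_def y_def vec_eq_iff forall_2)
  define E2 E3 P where
    "E2 = a2 r + (W - F * S^2 * (n * (n + 1))) * u2 r
            - 2 * F * S^2 * (1 - 3 * m * S + 2 * q^2 * S^2) * (u2 r - u3 r)" and
    "E3 = a3 r + (W - F * S^2 * (n * (n + 1))) * u3 r + 2 * F * S^2 * (n * (n + 1)) * u2 r" and
    "P = (4 * q^2 * S^4 - 6 * m * S^3) * F"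
  have minus: "n * E2 + E3 = (n * a2 r + a3 r) + (2 * n + 1) * ((W - F * S^2 * (n * (n - 1))) * x)
      + P * (n^2 * x - n * (n + 1) * y)"
    unfolding E2_def E3_def P_def u by algebra
  have plus: "(n + 1) * E2 - E3 = ((n + 1) * a2 r - a3 r)
      + (2 * n + 1) * ((W - F * S^2 * ((n + 1) * (n + 2))) * y)
      + P * (n * (n + 1) * x - (n + 1)^2 * y)"
    unfolding E2_def E3_def P_def u by algebra
  have cancel: "K * (A + (2 * n + 1) * B + C) = K * A + B + K * C" for A B C
    using K by algebra
  have components: "K * (n * a2 r + a3 r) + W * x
        + (- (F * S^2) * (n * (n - 1)) * x + P * K * (n^2 * x - n * (n + 1) * y))
      = K * (n * E2 + E3)"
    "K * ((n + 1) * a2 r - a3 r) + W * y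
        + (- (F * S^2) * ((n + 1) * (n + 2)) * y + P * K * (n * (n + 1) * x - (n + 1)^2 * y))
      = K * ((n + 1) * E2 - E3)"
    unfolding minus plus cancel by algebra+
  show ?thesis
    unfolding xy
    unfolding v coupling g c W_def[symmetric] P_def[symmetric] E2_def[symmetric] E3_def[symmetric]
    using components by (simp add: vec_eq_iff forall_2)
qed

lemma even_system_iff_even_matrix_system:
  assumes "M > 0" and "\<bar>Q\<bar> < M"
  shows "even_system M Q \<mu> \<omega> l rs u2 u3 \<longleftrightarrow>
         even_matrix_system M Q \<mu> \<omega> l rs (v_vec l u2 u3)"
proof
  assume "even_system M Q \<mu> \<omega> l rs u2 u3"
  then obtain a2 a3 where
    d: "has_second_rs_derivative M Q rs u2 a2" "has_second_rs_derivative M Q rs u3 a3"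
    and e: "\<forall>r\<in>exterior M Q.
       a2 r + (\<omega>\<^sup>2 - of_real (rn_f M Q r * \<mu>\<^sup>2)
         - of_real (rn_f M Q r * (real l * (real l + 1)) / r\<^sup>2)) * u2 r
         - of_real (2 * rn_f M Q r / r\<^sup>2 * (rn_f M Q r - r * deriv (rn_f M Q) r / 2))
           * (u2 r - u3 r) = 0 \<and>
       a3 r + (\<omega>\<^sup>2 - of_real (rn_f M Q r * \<mu>\<^sup>2)
         - of_real (rn_f M Q r * (real l * (real l + 1)) / r\<^sup>2)) * u3 r
         + of_real (2 * rn_f M Q r * (real l * (real l + 1)) / r\<^sup>2) * u2 r = 0"
    unfolding even_system_def Let_def by blast
  show "even_matrix_system M Q \<mu> \<omega> l rs (v_vec l u2 u3)"
    unfolding even_matrix_system_def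
  proof (intro exI conjI ballI)
    show "has_second_rs_derivative M Q rs (v_vec l u2 u3) (v_vec l a2 a3)"
      by (rule has_second_rs_derivative_v_vec[OF d])
    fix r assume r: "r \<in> exterior M Q"
    have "r \<noteq> 0" using exterior_pos[OF assms r] by simp
    from bspec[OF e r]
    show "v_vec l a2 a3 r + (\<omega>\<^sup>2 - of_real (rn_f M Q r * \<mu>\<^sup>2)) *s v_vec l u2 u3 r
        + even_coupling M Q l r (v_vec l u2 u3 r) = 0"
      unfolding matrix_residual[OF \<open>r \<noteq> 0\<close>] v_vec_eq_0_iff .
  qed
next
  assume "even_matrix_system M Q \<mu> \<omega> l rs (v_vec l u2 u3)"
  then obtain v'' where
    d: "has_second_rs_derivative M Q rs (v_vec l u2 u3) v''"
    and e: "\<forall>r\<in>exterior M Q. v'' r + (\<omega>\<^sup>2 - of_real (rn_f M Q r * \<mu>\<^sup>2)) *s v_vec l u2 u3 r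
        + even_coupling M Q l r (v_vec l u2 u3 r) = 0"
    unfolding even_matrix_system_def by blast
  define a2 a3 where "a2 = (\<lambda>r. v'' r $ 1 + v'' r $ 2)"
    and "a3 = (\<lambda>r. (of_nat l + 1) * v'' r $ 1 - of_nat l * v'' r $ 2)"
  have v'': "v'' r = v_vec l a2 a3 r" for r
    by (simp only: a2_def a3_def v_vec_of_inverse)
  have eqs: "a2 r + (\<omega>\<^sup>2 - of_real (rn_f M Q r * \<mu>\<^sup>2)
         - of_real (rn_f M Q r * (real l * (real l + 1)) / r\<^sup>2)) * u2 r
         - of_real (2 * rn_f M Q r / r\<^sup>2 * (rn_f M Q r - r * deriv (rn_f M Q) r / 2))
           * (u2 r - u3 r) = 0 \<and>
       a3 r + (\<omega>\<^sup>2 - of_real (rn_f M Q r * \<mu>\<^sup>2)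
         - of_real (rn_f M Q r * (real l * (real l + 1)) / r\<^sup>2)) * u3 r
         + of_real (2 * rn_f M Q r * (real l * (real l + 1)) / r\<^sup>2) * u2 r = 0"
    if r: "r \<in> exterior M Q" for r
  proof -
    have "r \<noteq> 0" using exterior_pos[OF assms r] by simp
    from bspec[OF e r] show ?thesis
      unfolding v'' matrix_residual[OF \<open>r \<noteq> 0\<close>] v_vec_eq_0_iff .
  qed
  have derivs: "has_second_rs_derivative M Q rs u2 a2" "has_second_rs_derivative M Q rs u3 a3"
    unfolding a2_def a3_def by (rule has_second_rs_derivative_from_v_vec[OF d])+
  show "even_system M Q \<mu> \<omega> l rs u2 u3"
    unfolding even_system_def Let_def
    by (rule exI[of _ a2], rule exI[of _ a3], intro conjI[OF derivs(1) conjI[OF derivs(2) ballI]])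
       (rule eqs)
qed

section \<open>Uniqueness of the expansion in inverse powers\<close>

text \<open>The numbers \<open>1 / r\<close> with \<open>r\<close> in a half-line are infinitely many zeros of one polynomial.\<close>

lemma inverse_power_coeffs_zero:
  fixes c :: "nat \<Rightarrow> complex"
  assumes "\<And>r. r > a \<Longrightarrow> (\<Sum>k\<le>n. c k * of_real (1 / r ^ k)) = 0" and "k \<le> n"
  shows "c k = 0"
proof (rule ccontr)
  assume "c k \<noteq> 0"
  then have fin: "finite {z. (\<Sum>k\<le>n. c k * z ^ k) = 0}"
    using \<open>k \<le> n\<close> by (subst polyfun_finite_roots) blast
  have "inj_on (\<lambda>r. of_real (1 / r) :: complex) {max a 0<..}"
    by (auto simp: inj_on_def)
  moreover have "infinite {max a 0<..}" by (rule infinite_Ioi)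
  ultimately have "infinite ((\<lambda>r. of_real (1 / r) :: complex) ` {max a 0<..})"
    by (simp add: finite_image_iff)
  moreover have "(\<lambda>r. of_real (1 / r) :: complex) ` {max a 0<..}
      \<subseteq> {z. (\<Sum>k\<le>n. c k * z ^ k) = 0}"
    using assms(1) by (auto simp: power_divide)
  ultimately show False using fin finite_subset by blast
qed

text \<open>After cancelling \<open>f\<close>, applying two expansions to the basis vectors compares them
  entry by entry, which reduces uniqueness to scalar polynomials in \<open>1 / r\<close>.\<close>

lemma coupling_expansion_unique:
  assumes "M > 0" and "\<bar>Q\<bar> < M"
    and A: "coupling_expansion M Q l A" and B: "coupling_expansion M Q l B"
  shows "A = B"
proof -
  have "finite ({k. A k \<noteq> 0} \<union> {k. B k \<noteq> 0})"
    using A B by (simp add: coupling_expansion_def)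
  then obtain n where n: "\<forall>k \<in> {k. A k \<noteq> 0} \<union> {k. B k \<noteq> 0}. k \<le> n"
    using finite_nat_set_iff_bounded_le by blast
  \<comment> \<open>The two sums range over different supports; a common range makes their difference one
    polynomial.\<close>
  have pad: "(\<Sum>k | X k \<noteq> 0. (1 / r ^ k) *\<^sub>R (X k *v x)) = (\<Sum>k\<le>n. (1 / r ^ k) *\<^sub>R (X k *v x))"
    if "X = A \<or> X = B" for X :: "nat \<Rightarrow> complex^2^2" and r x
    using n that by (intro sum.mono_neutral_left) auto
  have basis: "(X *v axis j 1) $ i = X $ i $ j" for X :: "complex^2^2" and i j
    by (simp add: matrix_vector_mult_def axis_def if_distrib cong: if_cong)
  have entry: "A k $ i $ j = B k $ i $ j" if "k \<le> n" for k i j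
  proof -
    have vanish: "(\<Sum>k\<le>n. (A k $ i $ j - B k $ i $ j) * of_real (1 / r ^ k)) = 0"
      if "r > r_plus M Q" for r
    proof -
      have r: "r \<in> exterior M Q" using that by simp
      have expand: "even_coupling M Q l r (axis j 1)
          = - (rn_f M Q r *\<^sub>R (\<Sum>k\<le>n. (1 / r ^ k) *\<^sub>R (X k *v axis j 1)))"
        if "coupling_expansion M Q l X" "X = A \<or> X = B" for X
        using that(1) r unfolding coupling_expansion_def pad[OF that(2)] by blast
      have "rn_f M Q r *\<^sub>R (\<Sum>k\<le>n. (1 / r ^ k) *\<^sub>R (A k *v axis j 1))
          = rn_f M Q r *\<^sub>R (\<Sum>k\<le>n. (1 / r ^ k) *\<^sub>R (B k *v axis j 1))"
        using expand[OF A] expand[OF B] by auto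
      then have "(\<Sum>k\<le>n. (1 / r ^ k) *\<^sub>R (A k *v axis j 1))
          = (\<Sum>k\<le>n. (1 / r ^ k) *\<^sub>R (B k *v axis j 1))"
        using rn_f_pos_exterior[OF assms(1,2) r] by simp
      then have "(\<Sum>k\<le>n. (1 / r ^ k) *\<^sub>R (A k *v axis j 1)) $ i
          = (\<Sum>k\<le>n. (1 / r ^ k) *\<^sub>R (B k *v axis j 1)) $ i"
        by (rule arg_cong)
      then have "(\<Sum>k\<le>n. (1 / r ^ k) *\<^sub>R (A k $ i $ j))
          = (\<Sum>k\<le>n. (1 / r ^ k) *\<^sub>R (B k $ i $ j))"
        by (simp add: basis)
      then show ?thesis
        by (simp add: scaleR_conv_of_real diff_divide_distrib sum_subtractf)
    qed
    have "A k $ i $ j - B k $ i $ j = 0"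
      by (rule inverse_power_coeffs_zero[where c = "\<lambda>k. A k $ i $ j - B k $ i $ j"])
         (rule vanish, assumption, rule \<open>k \<le> n\<close>)
    then show ?thesis by simp
  qed
  show "A = B"
  proof
    fix k show "A k = B k"
    proof (cases "k \<le> n")
      case True
      then show ?thesis by (simp add: vec_eq_iff entry)
    next
      case False
      then have "A k = 0" "B k = 0" using n by auto
      then show ?thesis by simp
    qed
  qed
qed

section \<open>The coefficients of the even coupling\<close>

definition even_coeff :: "real \<Rightarrow> real \<Rightarrow> nat \<Rightarrow> nat \<Rightarrow> complex^2^2" where
  "even_coeff M Q l k =
     (if k = 2 then D_mat l
      else if k = 3 then (6 * M / (2 * real l + 1)) *\<^sub>R C_mat l
      else if k = 4 then (- 4 * Q\<^sup>2 / (2 * real l + 1)) *\<^sub>R C_mat l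
      else 0)"

lemma scaleR_matrix_vector_mult:
  fixes A :: "complex^'n^'m"
  shows "(c *\<^sub>R A) *v x = c *\<^sub>R (A *v x)"
  by (simp add: vec_eq_iff matrix_vector_mult_def scaleR_sum_right)

lemma coupling_expansion_even_coeff: "coupling_expansion M Q l (even_coeff M Q l)"
proof -
  have supp: "{k. even_coeff M Q l k \<noteq> 0} \<subseteq> {2, 3, 4}"
    by (auto simp: even_coeff_def split: if_splits)
  have sum: "(\<Sum>k | even_coeff M Q l k \<noteq> 0. (1 / r ^ k) *\<^sub>R (even_coeff M Q l k *v x))
      = (\<Sum>k\<in>{2, 3, 4}. (1 / r ^ k) *\<^sub>R (even_coeff M Q l k *v x))" for r x
    using supp by (intro sum.mono_neutral_left) auto
  show ?thesis
    unfolding coupling_expansion_def sum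
  proof (intro conjI ballI allI)
    show "finite {k. even_coeff M Q l k \<noteq> 0}" using finite_subset[OF supp] by simp
  next
    fix r x
    show "even_coupling M Q l r x =
      - (rn_f M Q r *\<^sub>R (\<Sum>k\<in>{2, 3, 4}. (1 / r ^ k) *\<^sub>R (even_coeff M Q l k *v x)))"
      by (simp add: even_coupling_def even_coeff_def scaleR_matrix_vector_mult
          scaleR_matrix_vector_mult[of "-1", simplified]
          scaleR_add_right scaleR_diff_right mult_ac)
  qed
qed

theorem proposition2p1:
  fixes M Q \<mu> :: real and \<omega> :: complex and l :: nat and rs :: "real \<Rightarrow> real"
  assumes "M > 0" and "\<bar>Q\<bar> < M" and "\<mu> > 0" and "l \<ge> 1"
    and "tortoise_coordinate M Q rs"
  shows "(\<forall>u2 u3. even_system M Q \<mu> \<omega> l rs u2 u3 \<longleftrightarrow>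
                  even_matrix_system M Q \<mu> \<omega> l rs (v_vec l u2 u3)) \<and>
    D_mat l = diag2 (of_int (L_eff l (-1) * (L_eff l (-1) + 1)))
                    (of_int (L_eff l 1 * (L_eff l 1 + 1))) \<and>
    (\<exists>A. \<forall>q. \<bar>q\<bar> < M \<longrightarrow> coupling_expansion M q l (A q)) \<and>
    (\<forall>A. (\<forall>q. \<bar>q\<bar> < M \<longrightarrow> coupling_expansion M q l (A q)) \<longrightarrow>
         (\<forall>k<2. A Q k = 0) \<and> A Q 2 = D_mat l \<and>
         (\<forall>k<4. \<forall>q1 q2. \<bar>q1\<bar> < M \<longrightarrow> \<bar>q2\<bar> < M \<longrightarrow> A q1 k = A q2 k) \<and>
         (\<forall>q1 q2. \<bar>q1\<bar> < M \<longrightarrow> \<bar>q2\<bar> < M \<longrightarrow> \<bar>q1\<bar> \<noteq> \<bar>q2\<bar> \<longrightarrow>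
            A q1 4 $ 1 $ 2 \<noteq> A q2 4 $ 1 $ 2 \<and> A q1 4 $ 2 $ 1 \<noteq> A q2 4 $ 2 $ 1))"
proof (intro conjI)
  show "\<forall>u2 u3. even_system M Q \<mu> \<omega> l rs u2 u3 \<longleftrightarrow>
                even_matrix_system M Q \<mu> \<omega> l rs (v_vec l u2 u3)"
    using even_system_iff_even_matrix_system[OF assms(1,2)] by blast
  show "D_mat l = diag2 (of_int (L_eff l (-1) * (L_eff l (-1) + 1)))
                        (of_int (L_eff l 1 * (L_eff l 1 + 1)))"
    by (simp add: D_mat_def L_eff_def mult.commute add.assoc)
  show "\<exists>A. \<forall>q. \<bar>q\<bar> < M \<longrightarrow> coupling_expansion M q l (A q)"
    using coupling_expansion_even_coeff by (intro exI[of _ "\<lambda>q. even_coeff M q l"]) blast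
  show "\<forall>A. (\<forall>q. \<bar>q\<bar> < M \<longrightarrow> coupling_expansion M q l (A q)) \<longrightarrow>
         (\<forall>k<2. A Q k = 0) \<and> A Q 2 = D_mat l \<and>
         (\<forall>k<4. \<forall>q1 q2. \<bar>q1\<bar> < M \<longrightarrow> \<bar>q2\<bar> < M \<longrightarrow> A q1 k = A q2 k) \<and>
         (\<forall>q1 q2. \<bar>q1\<bar> < M \<longrightarrow> \<bar>q2\<bar> < M \<longrightarrow> \<bar>q1\<bar> \<noteq> \<bar>q2\<bar> \<longrightarrow>
            A q1 4 $ 1 $ 2 \<noteq> A q2 4 $ 1 $ 2 \<and> A q1 4 $ 2 $ 1 \<noteq> A q2 4 $ 2 $ 1)"
  proof (intro allI impI)
    fix A assume "\<forall>q. \<bar>q\<bar> < M \<longrightarrow> coupling_expansion M q l (A q)"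
    then have A: "A q = even_coeff M q l" if "\<bar>q\<bar> < M" for q
      using coupling_expansion_unique[OF assms(1) that _ coupling_expansion_even_coeff] that by blast
    have order4: "A q1 4 $ 1 $ 2 \<noteq> A q2 4 $ 1 $ 2 \<and> A q1 4 $ 2 $ 1 \<noteq> A q2 4 $ 2 $ 1"
      if q: "\<bar>q1\<bar> < M" "\<bar>q2\<bar> < M" "\<bar>q1\<bar> \<noteq> \<bar>q2\<bar>" for q1 q2
    proof -
      have "4 * q1\<^sup>2 / (2 * real l + 1) \<noteq> 4 * q2\<^sup>2 / (2 * real l + 1)"
        using q(3) by (simp add: power2_eq_iff abs_eq_iff)
      moreover have "C_mat l $ 1 $ 2 \<noteq> 0" "C_mat l $ 2 $ 1 \<noteq> 0"
        using assms(4) of_nat_neq_0[of l, where ?'a = complex]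
        by (auto simp: C_mat_def add.commute)
      ultimately show ?thesis
        unfolding A[OF q(1)] A[OF q(2)] by (simp add: even_coeff_def)
    qed
    show "(\<forall>k<2. A Q k = 0) \<and> A Q 2 = D_mat l \<and>
         (\<forall>k<4. \<forall>q1 q2. \<bar>q1\<bar> < M \<longrightarrow> \<bar>q2\<bar> < M \<longrightarrow> A q1 k = A q2 k) \<and>
         (\<forall>q1 q2. \<bar>q1\<bar> < M \<longrightarrow> \<bar>q2\<bar> < M \<longrightarrow> \<bar>q1\<bar> \<noteq> \<bar>q2\<bar> \<longrightarrow>
            A q1 4 $ 1 $ 2 \<noteq> A q2 4 $ 1 $ 2 \<and> A q1 4 $ 2 $ 1 \<noteq> A q2 4 $ 2 $ 1)"
      using order4 by (auto simp: A assms(2) even_coeff_def)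
  qed
qed

end
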